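(* Let $V$ be a closed pointed unbounded convex cone in $\mathbb{R}^2$. Then every $0$-minimal pair $(A,B)\in\mathcal{C}_V^2(\mathbb{R}^2)$ is reduced.
   Context: A cone $V$ is pointed if $V\cap(-V)=\{0\}$. $\mathcal{C}_V(\mathbb{R}^2)$ is the family of all nonempty closed convex sets $A\subset\mathbb{R}^2$ whose recession cone $\{x\in\mathbb{R}^2 \mid x+A\subset A\}$ equals $V$; $\mathcal{C}_V^2(\mathbb{R}^2)=\mathcal{C}_V(\mathbb{R}^2)\times\mathcal{C}_V(\mathbb{R}^2)$. Sums are Minkowski sums ($\mathcal{C}_V(\mathbb{R}^2)$ is closed under Minkowski addition). Pairs $(A,B),(C,D)\in\mathcal{C}_V^2(\mathbb{R}^2)$ are equivalent if $A+D=B+C$; this is an equivalence relation and $[A,B]$ denotes the class (a set of pairs) of $(A,B)$. Pairs are ordered by $(A_1,B_1)\prec(A_2,B_2)$ iff $A_1\subset A_2$ and $B_1\subset B_2$. A pair $(A,B)$ is $0$-minimal if it is a minimal element (with respect to $\prec$) of $\{(C,D)\in[A,B]\mid 0\in D\}$ (in particular $0\in B$). A pair $(A,B)\in\mathcal{C}_V^2(\mathbb{R}^2)$ is reduced if $[A,B]=\{(A+M,B+M)\mid M\in\mathcal{C}_V(\mathbb{R}^2)\}$. *)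

theory Defs
  imports "HOL-Analysis.Analysis" "HOL-Library.Set_Algebras"
begin

text \<open>Minkowski sums are the library's \<open>A + B\<close> on sets (\<^theory>\<open>HOL-Library.Set_Algebras\<close>), and
  \<open>x +o A\<close> is the translate of \<open>A\<close> by \<open>x\<close>. The library's \<^const>\<open>cone\<close> is closed under
  multiplication by all \<open>c \<ge> 0\<close>, so a nonempty cone contains \<open>0\<close>; the empty set is also a cone.\<close>

definition pointed_cone :: "'a::real_vector set \<Rightarrow> bool" where
  "pointed_cone V \<longleftrightarrow> cone V \<and> V \<inter> uminus ` V = {0}"

definition recession_cone :: "'a::real_vector set \<Rightarrow> 'a set" where
  "recession_cone A = {x. x +o A \<subseteq> A}"

definition closed_convex_family :: "'a::real_normed_vector set \<Rightarrow> 'a set set" where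
  "closed_convex_family V = {A. A \<noteq> {} \<and> closed A \<and> convex A \<and> recession_cone A = V}"

definition pair_class ::
  "'a::real_normed_vector set \<Rightarrow> 'a set \<times> 'a set \<Rightarrow> ('a set \<times> 'a set) set" where
  "pair_class V P =
    {(C, D). C \<in> closed_convex_family V \<and> D \<in> closed_convex_family V \<and> fst P + D = snd P + C}"

definition pair_le :: "'a set \<times> 'a set \<Rightarrow> 'a set \<times> 'a set \<Rightarrow> bool" (infix \<open>\<preceq>\<^sub>p\<close> 50) where
  "P \<preceq>\<^sub>p Q \<longleftrightarrow> fst P \<subseteq> fst Q \<and> snd P \<subseteq> snd Q"

definition minimal_pair_in :: "('a set \<times> 'a set) set \<Rightarrow> 'a set \<times> 'a set \<Rightarrow> bool" where
  "minimal_pair_in S P \<longleftrightarrow> P \<in> S \<and> (\<forall>Q\<in>S. Q \<preceq>\<^sub>p P \<longrightarrow> Q = P)"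

definition zero_minimal :: "'a::real_normed_vector set \<Rightarrow> 'a set \<times> 'a set \<Rightarrow> bool" where
  "zero_minimal V P \<longleftrightarrow> minimal_pair_in {(C, D) \<in> pair_class V P. 0 \<in> D} P"

definition reduced_pair :: "'a::real_normed_vector set \<Rightarrow> 'a set \<times> 'a set \<Rightarrow> bool" where
  "reduced_pair V P \<longleftrightarrow>
    pair_class V P = {(fst P + M, snd P + M) | M. M \<in> closed_convex_family V}"

end

theory Submission
  imports Defs
begin

text \<open>Two pairs are equivalent when \<open>A + D = B + C\<close>. The theorem rests on a refinement property of
  the plane: such an equation between members of the family can always be refined to
  \<open>A = P + Q\<close>, \<open>B = P + R\<close>, \<open>C = Q + S\<close>, \<open>D = R + S\<close> with \<open>P\<close>, \<open>Q\<close>, \<open>R\<close>, \<open>S\<close> in the family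
  (\<open>Riesz_refinement\<close>). Suppose this is known, and let \<open>(A, B)\<close> be 0-minimal and \<open>(C, D)\<close>
  equivalent to it. Since \<open>0 \<in> B = P + R\<close>, some \<open>p \<in> P\<close> has \<open>- p \<in> R\<close>. The pair
  \<open>(p + Q, p + R)\<close> is again equivalent to \<open>(A, B)\<close>, lies below it, and has \<open>0\<close> in its second
  member, so by minimality \<open>p + Q = A\<close> and \<open>p + R = B\<close>. Hence \<open>C = Q + S\<close> and
  \<open>D = R + S\<close> arise from \<open>A\<close> and \<open>B\<close> by adding the one set \<open>- p + S\<close>.

  To prove the refinement property, sets are translated into functions. Functionals that are
  strictly negative on \<open>V - {0}\<close> form, up to positive multiples, an open interval of slopes. On
  this interval the support functions of members of the family are exactly the finite convex
  functions, and Minkowski addition becomes pointwise addition (\<open>mem_family_iff\<close>,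
  \<open>supp_family_add\<close>, \<open>family_wulff\<close>). What remains is a statement about convex functions \<open>a\<close>, \<open>b\<close>,
  \<open>c\<close>, \<open>d\<close> of one variable with \<open>a + d = b + c\<close>: there is a convex \<open>q\<close> such that
  \<open>q - (a - b)\<close>, \<open>a - q\<close> and \<open>c - q\<close> are convex (\<open>convex_on_Riesz_interpolation\<close>).

  Passing to right slopes turns convex functions into nondecreasing ones, and the slope of \<open>q\<close> can
  be taken to be the positive variation of the function of bounded variation
  \<open>a' - b' = c' - d'\<close>: it has the least increments of all nondecreasing functions from which
  subtracting \<open>a' - b'\<close> leaves a nondecreasing function, and \<open>a'\<close> and \<open>c'\<close> are two of these
  (\<open>exists_least_mono_majorant\<close>). Integrating it gives \<open>q\<close>.\<close>

section \<open>Convex functions on an open interval and monotone slopes\<close>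

definition subgradient_on :: "real set \<Rightarrow> (real \<Rightarrow> real) \<Rightarrow> (real \<Rightarrow> real) \<Rightarrow> bool" where
  "subgradient_on I f \<alpha> \<longleftrightarrow> (\<forall>x\<in>I. \<forall>y\<in>I. f x + \<alpha> x * (y - x) \<le> f y)"

definition right_slope :: "real set \<Rightarrow> (real \<Rightarrow> real) \<Rightarrow> real \<Rightarrow> real" where
  "right_slope I f x = (INF t\<in>{x<..} \<inter> I. (f x - f t) / (x - t))"

lemma subgradient_on_mono:
  assumes "subgradient_on I f \<alpha>"
  shows "mono_on I \<alpha>"
proof (rule mono_onI)
  fix x y assume xy: "x \<in> I" "y \<in> I" "x \<le> y"
  have "f x + \<alpha> x * (y - x) \<le> f y" "f y + \<alpha> y * (x - y) \<le> f x"
    using assms xy by (auto simp: subgradient_on_def)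
  then have "(\<alpha> y - \<alpha> x) * (y - x) \<ge> 0" by (simp add: algebra_simps)
  then show "\<alpha> x \<le> \<alpha> y" using xy(3) by (cases "x = y") (auto simp: zero_le_mult_iff)
qed

lemma subgradient_on_imp_convex_on:
  assumes "subgradient_on I f \<alpha>" "convex I"
  shows "convex_on I f"
  unfolding convex_on_def
proof (intro conjI ballI allI impI)
  fix x y u v :: real assume *: "x \<in> I" "y \<in> I" "0 \<le> u" "0 \<le> v" "u + v = 1"
  define z where "z = u *\<^sub>R x + v *\<^sub>R y"
  have "z \<in> I" using assms(2) * by (auto simp: z_def convex_def)
  then have "f z + \<alpha> z * (x - z) \<le> f x" "f z + \<alpha> z * (y - z) \<le> f y"
    using assms(1) * by (auto simp: subgradient_on_def)
  then have "u * (f z + \<alpha> z * (x - z)) + v * (f z + \<alpha> z * (y - z)) \<le> u * f x + v * f y"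
    using * by (intro add_mono mult_left_mono)
  moreover have "u * (f z + \<alpha> z * (x - z)) + v * (f z + \<alpha> z * (y - z))
      = (u + v) * f z + \<alpha> z * (u * x + v * y - (u + v) * z)" by (simp add: algebra_simps)
  moreover have "\<dots> = f z" using *(5) by (simp add: z_def)
  ultimately show "f (u *\<^sub>R x + v *\<^sub>R y) \<le> u * f x + v * f y" by (simp add: z_def)
qed fact

lemma subgradient_on_right_slope:
  assumes "convex_on I f" "open I"
  shows "subgradient_on I f (right_slope I f)"
  unfolding subgradient_on_def right_slope_def
  using convex_le_Inf_differential[OF assms(1)] assms(2) by (simp add: interior_open)

text \<open>The difference quotient of a convex function is monotone, so the infimum that defines the right
  slope is a limit. This makes the right slope additive, which other choices of subgradients need
  not be.\<close>

lemma tendsto_right_slope: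
  assumes f: "convex_on I f" and "open I" "x \<in> I"
  shows "((\<lambda>t. (f x - f t) / (x - t)) \<longlongrightarrow> right_slope I f x) (at_right x)"
proof -
  obtain e where e: "e > 0" "{x - e<..<x + e} \<subseteq> I"
    using \<open>open I\<close> \<open>x \<in> I\<close> openE[of I x] by (metis ball_eq_greaterThanLessThan)
  let ?g = "\<lambda>t. (f x - f t) / (x - t)"
  have bdd: "bdd_below (?g ` ({x<..} \<inter> I))"
  proof (intro bdd_belowI)
    fix y assume "y \<in> ?g ` ({x<..} \<inter> I)"
    moreover have "x - e/2 \<in> I" using e by auto
    ultimately show "(f (x - e/2) - f x) / ((x - e/2) - x) \<le> y"
      using order_trans[OF convex_on_slope_le[OF f, of "x - e/2" _ x]] e(1) by auto
  qed
  have "x + e/2 \<in> {x<..} \<inter> I" using e by auto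
  then have ne: "?g ` ({x<..} \<inter> I) \<noteq> {}" by blast
  show ?thesis
  proof (rule order_tendstoI)
    fix a assume "a < right_slope I f x"
    then have "a < ?g t" if "t \<in> {x<..} \<inter> I" for t
      using cINF_lower[OF bdd that] unfolding right_slope_def by linarith
    moreover have "eventually (\<lambda>t. t \<in> {x<..} \<inter> I) (at_right x)"
      using e by (auto simp: eventually_at_right_field intro!: exI[of _ "x+e"])
    ultimately show "eventually (\<lambda>t. a < ?g t) (at_right x)"
      by (auto elim: eventually_mono)
  next
    fix a assume "right_slope I f x < a"
    then obtain t0 where t0: "t0 \<in> {x<..} \<inter> I" "?g t0 < a"
      unfolding right_slope_def using cINF_less_iff[OF _ bdd] ne by auto
    have "?g t < a" if "x < t" "t < t0" for t
      using convex_on_slope_le(1)[OF f \<open>x \<in> I\<close> _ that] t0 by auto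
    then show "eventually (\<lambda>t. ?g t < a) (at_right x)"
      using t0 by (auto simp: eventually_at_right_field)
  qed
qed

lemma right_slope_add:
  assumes "convex_on I f" "convex_on I g" "open I" "x \<in> I"
  shows "right_slope I (\<lambda>t. f t + g t) x = right_slope I f x + right_slope I g x"
proof (rule tendsto_unique)
  show "((\<lambda>t. (f x + g x - (f t + g t)) / (x - t)) \<longlongrightarrow> right_slope I (\<lambda>t. f t + g t) x) (at_right x)"
    using tendsto_right_slope[OF convex_on_add[OF assms(1,2)] assms(3,4)] .
  have "((\<lambda>t. (f x - f t) / (x - t) + (g x - g t) / (x - t))
      \<longlongrightarrow> right_slope I f x + right_slope I g x) (at_right x)"
    using assms by (intro tendsto_add tendsto_right_slope)
  then show "((\<lambda>t. (f x + g x - (f t + g t)) / (x - t))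
      \<longlongrightarrow> right_slope I f x + right_slope I g x) (at_right x)"
    by (simp add: add_divide_distrib[symmetric] algebra_simps)
qed auto

text \<open>A quadratically small deficit of the increments on all subintervals is no deficit at all: cutting
  an interval in half replaces the error \<open>(T y - T x) * (y - x)\<close> by the sum of two errors that is
  half as large, so the error on \<open>[x, y]\<close> can be divided by \<open>2 ^ n\<close> for every \<open>n\<close>.\<close>

lemma increment_nonneg_by_bisection:
  fixes F T :: "real \<Rightarrow> real"
  assumes "x \<le> y"
    and F: "\<And>s t. x \<le> s \<Longrightarrow> s \<le> t \<Longrightarrow> t \<le> y \<Longrightarrow> F t - F s \<ge> - ((T t - T s) * (t - s))"
  shows "F x \<le> F y"
proof -
  have step: "F t - F s \<ge> - ((T t - T s) * (t - s)) / 2 ^ n"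
    if "x \<le> s" "s \<le> t" "t \<le> y" for s t n
    using that
  proof (induction n arbitrary: s t)
    case 0
    then show ?case using F by simp
  next
    case (Suc n)
    define m where "m = (s + t) / 2"
    have m: "s \<le> m" "m \<le> t" "m - s = (t - s) / 2" "t - m = (t - s) / 2"
      using Suc.prems by (auto simp: m_def field_simps)
    have "F m - F s \<ge> - ((T m - T s) * (m - s)) / 2 ^ n"
      "F t - F m \<ge> - ((T t - T m) * (t - m)) / 2 ^ n"
      by (rule Suc.IH; use Suc.prems m(1,2) in linarith)+
    then have "F t - F s \<ge> - ((T m - T s) * (m - s)) / 2 ^ n + - ((T t - T m) * (t - m)) / 2 ^ n"
      by linarith
    also have "- ((T m - T s) * (m - s)) / 2 ^ n + - ((T t - T m) * (t - m)) / 2 ^ n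
        = - ((T t - T s) * (t - s)) / 2 ^ Suc n"
      unfolding m by (simp add: field_simps)
    finally show ?case .
  qed
  have "(\<lambda>n. - ((T y - T x) * (y - x)) * (1/2) ^ n) \<longlonglongrightarrow> - ((T y - T x) * (y - x)) * 0"
    by (intro tendsto_intros LIMSEQ_realpow_zero) auto
  then have "(\<lambda>n. - ((T y - T x) * (y - x)) / 2 ^ n) \<longlonglongrightarrow> 0"
    by (simp add: power_divide)
  then have "0 \<le> F y - F x"
    by (rule LIMSEQ_le_const2) (use step[of x y] assms(1) in auto)
  then show ?thesis by simp
qed

text \<open>The subgradient inequality of the subtrahend points the wrong way. Evaluating \<open>\<theta>\<close> at the other end
  of an interval \<open>[s, t]\<close> turns it round at the cost of an error \<open>(\<theta> t - \<theta> s) * (t - s)\<close>, which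
  bisection removes.\<close>

lemma subgradient_on_diff:
  assumes f: "subgradient_on I f \<alpha>" and g: "subgradient_on I g \<theta>"
    and mono: "mono_on I (\<lambda>t. \<alpha> t - \<theta> t)" and "convex I"
  shows "subgradient_on I (\<lambda>t. f t - g t) (\<lambda>t. \<alpha> t - \<theta> t)"
  unfolding subgradient_on_def
proof (intro ballI)
  fix x y assume xy: "x \<in> I" "y \<in> I"
  have I: "t \<in> I" if "a \<le> t" "t \<le> b" "a \<in> I" "b \<in> I" for a b t
    using \<open>convex I\<close> that by (meson atLeastAtMost_iff closed_segment_subset is_interval_convex_1 mem_is_interval_1_I)
  let ?h = "\<lambda>t. f t - g t" and ?\<eta> = "\<lambda>t. \<alpha> t - \<theta> t"
  have inc: "f s + \<alpha> s * (t - s) \<le> f t" "g s + \<theta> s * (t - s) \<le> g t" if "s \<in> I" "t \<in> I" for s t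
    using f g that by (auto simp: subgradient_on_def)
  show "?h x + ?\<eta> x * (y - x) \<le> ?h y"
  proof (cases "x \<le> y")
    case True
    have "?h x - ?\<eta> x * x \<le> ?h y - ?\<eta> x * y"
    proof (rule increment_nonneg_by_bisection[where T = \<theta>, OF True])
      fix s t assume st: "x \<le> s" "s \<le> t" "t \<le> y"
      then have mem: "s \<in> I" "t \<in> I" using I[OF _ _ xy] by auto
      have "?\<eta> x * (t - s) \<le> ?\<eta> s * (t - s)"
        using mono_onD[OF mono xy(1) mem(1)] st by (intro mult_right_mono) auto
      then show "?h t - ?\<eta> x * t - (?h s - ?\<eta> x * s) \<ge> - ((\<theta> t - \<theta> s) * (t - s))"
        using inc(1)[OF mem] inc(2)[OF mem(2,1)] by (simp add: algebra_simps)
    qed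
    then show ?thesis by (simp add: algebra_simps)
  next
    case False
    then have yx: "y \<le> x" by simp
    have "?\<eta> x * y - ?h y \<le> ?\<eta> x * x - ?h x"
    proof (rule increment_nonneg_by_bisection[where T = \<theta>, OF yx])
      fix s t assume st: "y \<le> s" "s \<le> t" "t \<le> x"
      then have mem: "s \<in> I" "t \<in> I" using I[OF _ _ xy(2,1)] by auto
      have "?\<eta> t * (t - s) \<le> ?\<eta> x * (t - s)"
        using mono_onD[OF mono mem(2) xy(1)] st by (intro mult_right_mono) auto
      then show "?\<eta> x * t - ?h t - (?\<eta> x * s - ?h s) \<ge> - ((\<theta> t - \<theta> s) * (t - s))"
        using inc(1)[OF mem(2,1)] inc(2)[OF mem] by (simp add: algebra_simps)
    qed
    then show ?thesis by (simp add: algebra_simps)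
  qed
qed

lemma exists_primitive_of_mono:
  assumes mono: "mono_on I \<theta>" and "convex I"
  shows "\<exists>g. subgradient_on I g \<theta>"
proof (cases "I = {}")
  case False
  then obtain c where c: "c \<in> I" by auto
  have sub: "{a..b} \<subseteq> I" if "a \<in> I" "b \<in> I" for a b
    using \<open>convex I\<close> that by (meson atLeastAtMost_iff is_interval_convex_1 mem_is_interval_1_I subsetI)
  have int: "\<theta> integrable_on {a..b}" if "a \<in> I" "b \<in> I" for a b
    by (rule integrable_on_mono_on) (rule mono_on_subset[OF mono sub[OF that]])
  define g where "g t = (if c \<le> t then integral {c..t} \<theta> else - integral {t..c} \<theta>)" for t
  have diff: "g y - g x = integral {x..y} \<theta>" if "x \<in> I" "y \<in> I" "x \<le> y" for x y
  proof -
    consider "c \<le> x" | "x < c" "c \<le> y" | "y < c" by linarith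
    then show ?thesis
    proof cases
      case 1
      then show ?thesis
        using Henstock_Kurzweil_Integration.integral_combine[of c x y \<theta>] int[OF c that(2)] that
        by (simp add: g_def)
    next
      case 2
      then show ?thesis
        using Henstock_Kurzweil_Integration.integral_combine[of x c y \<theta>] int[OF that(1,2)]
        by (simp add: g_def)
    next
      case 3
      then show ?thesis
        using Henstock_Kurzweil_Integration.integral_combine[of x y c \<theta>] int[OF that(1) c] that
        by (simp add: g_def)
    qed
  qed
  have bounds: "\<theta> x * (y - x) \<le> g y - g x" "g y - g x \<le> \<theta> y * (y - x)"
    if "x \<in> I" "y \<in> I" "x \<le> y" for x y
  proof -
    have m: "\<theta> x \<le> \<theta> t" "\<theta> t \<le> \<theta> y" if "t \<in> {x..y}" for t
      using mono_onD[OF mono \<open>x \<in> I\<close>, of t] mono_onD[OF mono _ \<open>y \<in> I\<close>, of t]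
        sub[OF \<open>x \<in> I\<close> \<open>y \<in> I\<close>] that by auto
    have "integral {x..y} (\<lambda>_. \<theta> x) \<le> integral {x..y} \<theta>"
      using m int[OF that(1,2)] by (intro integral_le) auto
    then show "\<theta> x * (y - x) \<le> g y - g x" using diff[OF that] that by (simp add: mult.commute)
    have "integral {x..y} \<theta> \<le> integral {x..y} (\<lambda>_. \<theta> y)"
      using m int[OF that(1,2)] by (intro integral_le) auto
    then show "g y - g x \<le> \<theta> y * (y - x)" using diff[OF that] that by (simp add: mult.commute)
  qed
  have "g x + \<theta> x * (y - x) \<le> g y" if "x \<in> I" "y \<in> I" for x y
    using bounds(1)[of x y] bounds(2)[of y x] that by (cases "x \<le> y") (auto simp: algebra_simps)
  then show ?thesis by (auto simp: subgradient_on_def)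
qed (auto simp: subgradient_on_def)

text \<open>The least \<open>\<theta>\<close> is the positive variation of \<open>\<phi>\<close>. It is obtained without partitions: its
  increment over \<open>[x, y]\<close> is the infimum of the increments of all \<open>\<psi>\<close> in \<open>\<Psi>\<close>. This infimum is
  additive over adjacent intervals because two members of \<open>\<Psi>\<close> can be glued at any point.\<close>

lemma exists_least_mono_majorant:
  fixes \<phi> :: "real \<Rightarrow> real" and I :: "real set"
  defines "\<Psi> \<equiv> {\<psi>. mono_on I \<psi> \<and> mono_on I (\<lambda>t. \<psi> t - \<phi> t)}"
  assumes "\<Psi> \<noteq> {}"
  shows "\<exists>\<theta>\<in>\<Psi>. \<forall>\<psi>\<in>\<Psi>. mono_on I (\<lambda>t. \<psi> t - \<theta> t)"
proof (cases "I = {}")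
  case True
  then show ?thesis using assms(2) by (auto simp: mono_on_def)
next
  case False
  then obtain c where c: "c \<in> I" by auto
  define P where "P x y = (INF \<psi>\<in>\<Psi>. \<psi> y - \<psi> x)" for x y
  have inc: "\<psi> x \<le> \<psi> y" "\<phi> y - \<phi> x \<le> \<psi> y - \<psi> x" if "\<psi> \<in> \<Psi>" "x \<in> I" "y \<in> I" "x \<le> y" for \<psi> x y
    using that by (auto simp: \<Psi>_def mono_on_def) (smt (verit))
  have lower: "P x y \<le> \<psi> y - \<psi> x" if "\<psi> \<in> \<Psi>" "x \<in> I" "y \<in> I" "x \<le> y" for \<psi> x y
    unfolding P_def
    by (rule cINF_lower[OF bdd_belowI[of _ 0]]) (use inc(1) that in \<open>auto simp: diff_ge_0_iff_ge\<close>)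
  have greatest: "r \<le> P x y" if "\<And>\<psi>. \<psi> \<in> \<Psi> \<Longrightarrow> r \<le> \<psi> y - \<psi> x" for r x y
    unfolding P_def by (rule cINF_greatest[OF assms(2)]) (use that in auto)
  have add: "P x z = P x y + P y z" if xyz: "x \<in> I" "y \<in> I" "z \<in> I" "x \<le> y" "y \<le> z" for x y z
  proof (rule antisym)
    show "P x y + P y z \<le> P x z"
    proof (rule greatest)
      fix \<psi> assume "\<psi> \<in> \<Psi>"
      then show "P x y + P y z \<le> \<psi> z - \<psi> x"
        using lower[of \<psi> x y] lower[of \<psi> y z] xyz by auto
    qed
    have "P x z \<le> (\<psi>1 y - \<psi>1 x) + (\<psi>2 z - \<psi>2 y)" if \<psi>: "\<psi>1 \<in> \<Psi>" "\<psi>2 \<in> \<Psi>" for \<psi>1 \<psi>2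
    proof -
      \<comment> \<open>\<open>\<psi>1\<close> up to \<open>y\<close>, then \<open>\<psi>2\<close> shifted so as to continue from the value \<open>\<psi>1 y\<close>.\<close>
      define \<psi> where "\<psi> t = (if t \<le> y then \<psi>1 t else \<psi>1 y + (\<psi>2 t - \<psi>2 y))" for t
      have "\<psi> s \<le> \<psi> t \<and> \<psi> s - \<phi> s \<le> \<psi> t - \<phi> t" if st: "s \<in> I" "t \<in> I" "s \<le> t" for s t
        using inc[OF \<psi>(1), of s t] inc[OF \<psi>(1), of s y] inc[OF \<psi>(2), of y t]
          inc[OF \<psi>(2), of s t] st xyz(2)
        by (auto simp: \<psi>_def split: if_splits)
      then have "\<psi> \<in> \<Psi>" by (auto simp: \<Psi>_def mono_on_def)
      from lower[OF this xyz(1,3)] show ?thesis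
        using xyz by (auto simp: \<psi>_def split: if_splits)
    qed
    then have "P x z - (\<psi>2 z - \<psi>2 y) \<le> P x y" if "\<psi>2 \<in> \<Psi>" for \<psi>2
      using that by (intro greatest) (auto simp: algebra_simps)
    then have "P x z - P x y \<le> P y z"
      by (intro greatest) (smt (verit))
    then show "P x z \<le> P x y + P y z" by simp
  qed
  define \<theta> where "\<theta> t = (if c \<le> t then P c t else - P t c)" for t
  have diff: "\<theta> y - \<theta> x = P x y" if "x \<in> I" "y \<in> I" "x \<le> y" for x y
    using that c add[of c x y] add[of x c y] add[of x y c] by (auto simp: \<theta>_def)
  have "\<theta> x \<le> \<theta> y \<and> \<theta> x - \<phi> x \<le> \<theta> y - \<phi> y" if xy: "x \<in> I" "y \<in> I" "x \<le> y" for x y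
    using diff[OF xy] greatest[of 0 y x] greatest[of "\<phi> y - \<phi> x" y x] inc[OF _ xy] by force
  then have "\<theta> \<in> \<Psi>" by (auto simp: \<Psi>_def mono_on_def)
  moreover have "mono_on I (\<lambda>t. \<psi> t - \<theta> t)" if "\<psi> \<in> \<Psi>" for \<psi>
  proof (rule mono_onI)
    fix x y assume "x \<in> I" "y \<in> I" "x \<le> y"
    then show "\<psi> x - \<theta> x \<le> \<psi> y - \<theta> y" using lower[OF that] diff by (smt (verit))
  qed
  ultimately show ?thesis by auto
qed

text \<open>In the order where \<open>f\<close> is below \<open>g\<close> if \<open>g - f\<close> is convex, \<open>q\<close> lies between the lower bounds
  \<open>0\<close>, \<open>a - b\<close> and the upper bounds \<open>a\<close>, \<open>c\<close>. The \<open>q\<close> constructed here is the supremum of the two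
  lower bounds, because the increments of its slope are the least possible ones.\<close>

lemma convex_on_Riesz_interpolation:
  fixes a b c d :: "real \<Rightarrow> real"
  assumes "open I"
    and a: "convex_on I a" and b: "convex_on I b" and c: "convex_on I c" and d: "convex_on I d"
    and eq: "\<And>t. t \<in> I \<Longrightarrow> a t + d t = b t + c t"
  shows "\<exists>q. convex_on I q \<and> convex_on I (\<lambda>t. q t - (a t - b t))
    \<and> convex_on I (\<lambda>t. a t - q t) \<and> convex_on I (\<lambda>t. c t - q t)"
proof -
  have "convex I" using a by (simp add: convex_on_def)
  let ?\<alpha> = "right_slope I a" and ?\<beta> = "right_slope I b"
    and ?\<gamma> = "right_slope I c" and ?\<delta> = "right_slope I d"
  note sub = subgradient_on_right_slope[OF _ \<open>open I\<close>]
  note mono = subgradient_on_mono[OF sub]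
  have slopes: "?\<alpha> t - ?\<beta> t = ?\<gamma> t - ?\<delta> t" if "t \<in> I" for t
  proof -
    have "right_slope I (\<lambda>t. a t + d t) t = right_slope I (\<lambda>t. b t + c t) t"
      unfolding right_slope_def by (rule INF_cong) (use eq that in auto)
    then show ?thesis using right_slope_add a b c d \<open>open I\<close> that by simp
  qed
  let ?\<phi> = "\<lambda>t. ?\<alpha> t - ?\<beta> t"
  define \<Psi> where "\<Psi> = {\<psi>. mono_on I \<psi> \<and> mono_on I (\<lambda>t. \<psi> t - ?\<phi> t)}"
  have \<alpha>: "?\<alpha> \<in> \<Psi>" using mono[OF a] mono[OF b] by (simp add: \<Psi>_def)
  have "mono_on I (\<lambda>t. ?\<gamma> t - ?\<phi> t)"
    using mono[OF d] slopes by (simp add: mono_on_def)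
  then have \<gamma>: "?\<gamma> \<in> \<Psi>" using mono[OF c] by (simp add: \<Psi>_def)
  obtain \<theta> where \<theta>: "\<theta> \<in> \<Psi>" and min: "\<And>\<psi>. \<psi> \<in> \<Psi> \<Longrightarrow> mono_on I (\<lambda>t. \<psi> t - \<theta> t)"
    using exists_least_mono_majorant[of I ?\<phi>] \<alpha> unfolding \<Psi>_def by blast
  have \<theta>_mono: "mono_on I \<theta>" "mono_on I (\<lambda>t. ?\<beta> t - (?\<alpha> t - \<theta> t))"
    using \<theta> by (auto simp: \<Psi>_def algebra_simps)
  obtain q where q: "subgradient_on I q \<theta>"
    using exists_primitive_of_mono[OF \<theta>_mono(1) \<open>convex I\<close>] by auto
  have aq: "subgradient_on I (\<lambda>t. a t - q t) (\<lambda>t. ?\<alpha> t - \<theta> t)"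
    using subgradient_on_diff[OF sub[OF a] q min[OF \<alpha>] \<open>convex I\<close>] .
  have cq: "subgradient_on I (\<lambda>t. c t - q t) (\<lambda>t. ?\<gamma> t - \<theta> t)"
    using subgradient_on_diff[OF sub[OF c] q min[OF \<gamma>] \<open>convex I\<close>] .
  have "subgradient_on I (\<lambda>t. b t - (a t - q t)) (\<lambda>t. ?\<beta> t - (?\<alpha> t - \<theta> t))"
    using subgradient_on_diff[OF sub[OF b] aq \<theta>_mono(2) \<open>convex I\<close>] .
  then have "convex_on I (\<lambda>t. q t - (a t - b t))"
    using subgradient_on_imp_convex_on[OF _ \<open>convex I\<close>] by (fastforce simp: algebra_simps)
  then show ?thesis
    using subgradient_on_imp_convex_on[OF _ \<open>convex I\<close>] q aq cq by blast
qed

section \<open>Planar convex sets with a prescribed recession cone\<close>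

text \<open>The vector \<open>v\<close> serves to normalise functionals: every functional that is negative on
  \<open>V - {0}\<close> can be scaled to have inner product \<open>- (v \<bullet> v)\<close> with \<open>v\<close>, and these functionals form
  a line, which \<open>dir\<close> parametrises by the component orthogonal to \<open>v\<close>.\<close>

locale planar_cone =
  fixes V :: "(real ^ 2) set" and v :: "real ^ 2"
  assumes closed_V: "closed V" and convex_V: "convex V" and pointed_V: "pointed_cone V"
    and v: "v \<in> V" "v \<noteq> 0"
begin

definition dir :: "real \<Rightarrow> real ^ 2" where
  "dir s = s *\<^sub>R vector [- (v $ 2), v $ 1] - v"

text \<open>The parameters of the functionals in the interior of the polar cone of \<open>V\<close>.\<close>

definition slopes :: "real set" where
  "slopes = {s. \<forall>y\<in>V - {0}. dir s \<bullet> y < 0}"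

definition supp :: "(real ^ 2) set \<Rightarrow> real \<Rightarrow> real" where
  "supp A s = (SUP x\<in>A. dir s \<bullet> x)"

text \<open>The Wulff shape of \<open>f\<close>, the largest set whose support function is at most \<open>f\<close>.\<close>

definition wulff :: "(real \<Rightarrow> real) \<Rightarrow> (real ^ 2) set" where
  "wulff f = {x. \<forall>s\<in>slopes. dir s \<bullet> x \<le> f s}"

abbreviation family :: "(real ^ 2) set set" where
  "family \<equiv> closed_convex_family V"

lemma cone_facts:
  shows zero_V: "0 \<in> V"
    and scale_V: "x \<in> V \<Longrightarrow> 0 \<le> c \<Longrightarrow> c *\<^sub>R x \<in> V"
    and pointed: "x \<in> V \<Longrightarrow> - x \<in> V \<Longrightarrow> x = 0"
    and add_V: "x \<in> V \<Longrightarrow> y \<in> V \<Longrightarrow> x + y \<in> V"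
proof -
  have c: "cone V" and p: "V \<inter> uminus ` V = {0}"
    using pointed_V by (auto simp: pointed_cone_def)
  show "0 \<in> V" using p by auto
  show "x \<in> V \<Longrightarrow> 0 \<le> c \<Longrightarrow> c *\<^sub>R x \<in> V" using c by (simp add: cone_def)
  show "x \<in> V \<Longrightarrow> - x \<in> V \<Longrightarrow> x = 0" using p by force
  show "x \<in> V \<Longrightarrow> y \<in> V \<Longrightarrow> x + y \<in> V"
    using c convex_V convex_cone[of V] by auto
qed

lemma dir_affine: "u + w = 1 \<Longrightarrow> dir (u * s + w * t) = u *\<^sub>R dir s + w *\<^sub>R dir t"
proof -
  assume "u + w = 1"
  then have "v = u *\<^sub>R v + w *\<^sub>R v" by (metis scaleR_left.add scaleR_one)
  then show ?thesis unfolding dir_def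
    by (metis (no_types, opaque_lifting) add_diff_add scaleR_left.add scaleR_right_diff_distrib scaleR_scaleR)
qed

lemma norm_v_pos: "(v $ 1)\<^sup>2 + (v $ 2)\<^sup>2 > 0"
  using v(2) by (auto simp: vec_eq_iff forall_2 sum_power2_gt_zero_iff)

lemma functional_is_multiple_of_dir:
  assumes "u \<bullet> v < 0"
  shows "\<exists>l>0. \<exists>s. u = l *\<^sub>R dir s"
proof -
  let ?n = "(v $ 1)\<^sup>2 + (v $ 2)\<^sup>2"
  define l where "l = - (u \<bullet> v) / ?n"
  define s where "s = (u $ 2 * v $ 1 - u $ 1 * v $ 2) / (l * ?n)"
  have l: "l > 0" using assms norm_v_pos by (simp add: l_def divide_neg_pos)
  have "l * ?n = - (u $ 1 * v $ 1 + u $ 2 * v $ 2)"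
    using norm_v_pos by (simp add: l_def inner_vec_def sum_2)
  moreover have "l * s * ?n = u $ 2 * v $ 1 - u $ 1 * v $ 2"
  proof -
    have "l * s * ?n = (u $ 2 * v $ 1 - u $ 1 * v $ 2) * (l * ?n) / (l * ?n)"
      by (simp only: s_def times_divide_eq_left times_divide_eq_right mult_ac)
    also have "\<dots> = u $ 2 * v $ 1 - u $ 1 * v $ 2"
      by (rule nonzero_mult_div_cancel_right) (use l norm_v_pos in auto)
    finally show ?thesis .
  qed
  ultimately have "u $ 1 * ?n = (l * (s * (- v $ 2) - v $ 1)) * ?n"
    "u $ 2 * ?n = (l * (s * v $ 1 - v $ 2)) * ?n"
    by algebra+
  then have "u = l *\<^sub>R dir s"
    using norm_v_pos by (auto simp: dir_def vec_eq_iff forall_2)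
  then show ?thesis using l by blast
qed

text \<open>The points of the plane correspond to the affine functions on the line of functionals. A supporting
  line of a convex function thus comes from a point of its Wulff shape.\<close>

lemma exists_prescribed_values:
  "\<exists>x. \<forall>s. dir s \<bullet> x = p + k * s"
proof -
  let ?n = "(v $ 1)\<^sup>2 + (v $ 2)\<^sup>2"
  define x :: "real ^ 2" where "x = (1 / ?n) *\<^sub>R (k *\<^sub>R vector [- (v $ 2), v $ 1] - p *\<^sub>R v)"
  have "dir s \<bullet> x = p + k * s" for s
  proof -
    have "dir s \<bullet> x = (1 / ?n) * (dir s \<bullet> (k *\<^sub>R vector [- (v $ 2), v $ 1] - p *\<^sub>R v))"
      by (simp add: x_def)
    also have "dir s \<bullet> (k *\<^sub>R vector [- (v $ 2), v $ 1] - p *\<^sub>R v) = (p + k * s) * ?n"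
      by (simp add: dir_def inner_vec_def sum_2 algebra_simps power2_eq_square)
    finally have "dir s \<bullet> x = (p + k * s) * ?n / ?n" by (simp only: times_divide_eq_left mult_1)
    also have "\<dots> = p + k * s"
      by (rule nonzero_mult_div_cancel_right) (use norm_v_pos in auto)
    finally show ?thesis .
  qed
  then show ?thesis by blast
qed

lemma sphere_V: "compact (V \<inter> sphere 0 1)"
  using closed_V by (simp add: closed_Int_compact)

lemma negative_iff_on_sphere:
  "(\<forall>y\<in>V - {0}. u \<bullet> y < 0) \<longleftrightarrow> (\<forall>y\<in>V \<inter> sphere 0 1. u \<bullet> y < 0)"
proof (intro iffI ballI)
  fix y assume *: "\<forall>y\<in>V \<inter> sphere 0 1. u \<bullet> y < 0" "y \<in> V - {0}"
  have "(1 / norm y) *\<^sub>R y \<in> V \<inter> sphere 0 1" using * scale_V[of y "1 / norm y"] by simp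
  then have "u \<bullet> ((1 / norm y) *\<^sub>R y) < 0" using *(1) by blast
  then show "u \<bullet> y < 0" using *(2) by (simp add: divide_less_0_iff split: if_splits)
qed auto

lemma convex_slopes: "convex slopes"
proof (rule convexI)
  fix s t u w :: real assume *: "s \<in> slopes" "t \<in> slopes" "0 \<le> u" "0 \<le> w" "u + w = 1"
  have "u * (dir s \<bullet> y) + w * (dir t \<bullet> y) < 0" if "y \<in> V - {0}" for y
  proof -
    have "dir s \<bullet> y < 0" "dir t \<bullet> y < 0" using *(1,2) that by (auto simp: slopes_def)
    then show ?thesis using *(3-5) convex_bound_lt[of "dir s \<bullet> y" 0 "dir t \<bullet> y" u w] by auto
  qed
  then show "u *\<^sub>R s + w *\<^sub>R t \<in> slopes"
    using *(5) by (simp add: slopes_def dir_affine inner_add_left)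
qed

text \<open>A functional that is negative on the compact set \<open>V \<inter> sphere 0 1\<close> is bounded away from \<open>0\<close>
  there, so a small perturbation stays negative.\<close>

lemma open_slopes: "open slopes"
proof -
  let ?K = "V \<inter> sphere 0 1"
  have "v /\<^sub>R norm v \<in> ?K" using v scale_V[OF v(1), of "inverse (norm v)"] by auto
  then have ne: "?K \<noteq> {}" by blast
  have "\<exists>e>0. ball s e \<subseteq> slopes" if "s \<in> slopes" for s
  proof -
    let ?w = "vector [- (v $ 2), v $ 1] :: real ^ 2"
    have "continuous_on ?K (\<lambda>y. dir s \<bullet> y)" by (intro continuous_intros)
    then obtain y0 where y0: "y0 \<in> ?K" "\<forall>y\<in>?K. dir s \<bullet> y \<le> dir s \<bullet> y0"
      using continuous_attains_sup[OF sphere_V ne] by blast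
    define m where "m = - (dir s \<bullet> y0)"
    have "y0 \<noteq> 0" using y0(1) by auto
    then have m: "m > 0" using that y0(1) by (auto simp: slopes_def m_def)
    define e where "e = m / (norm ?w + 1)"
    have n: "norm ?w + 1 > 0" by (simp add: add_nonneg_pos)
    have "t \<in> slopes" if "t \<in> ball s e" for t
      unfolding slopes_def mem_Collect_eq negative_iff_on_sphere
    proof
      fix y assume y: "y \<in> ?K"
      have "dir t = dir s + (t - s) *\<^sub>R ?w" by (simp add: dir_def algebra_simps)
      then have "dir t \<bullet> y = dir s \<bullet> y + (t - s) * (?w \<bullet> y)" by (simp add: inner_add_left)
      also have "(t - s) * (?w \<bullet> y) \<le> \<bar>t - s\<bar> * \<bar>?w \<bullet> y\<bar>" by (metis abs_ge_self abs_mult)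
      also have "\<dots> \<le> \<bar>t - s\<bar> * norm ?w"
        using Cauchy_Schwarz_ineq2[of ?w y] y by (intro mult_left_mono) auto
      also have "\<dots> \<le> \<bar>t - s\<bar> * (norm ?w + 1)" by (intro mult_left_mono) auto
      also have "\<dots> < m" using that n by (auto simp: e_def dist_real_def field_simps abs_minus_commute)
      finally have "dir t \<bullet> y < dir s \<bullet> y + m" by simp
      moreover have "dir s \<bullet> y \<le> - m" using y0(2) y by (simp add: m_def)
      ultimately show "dir t \<bullet> y < 0" by linarith
    qed
    moreover have "e > 0" using m n by (simp add: e_def)
    ultimately show ?thesis by blast
  qed
  then show ?thesis by (simp add: open_contains_ball)
qed

text \<open>Pointedness makes \<open>V - {0}\<close> convex, so the convex hull of \<open>V \<inter> sphere 0 1\<close> is a compact set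
  that misses \<open>0\<close> and can be strictly separated from it.\<close>

lemma slopes_nonempty: "slopes \<noteq> {}"
proof -
  let ?K = "V \<inter> sphere 0 1"
  have "convex (V - {0})"
  proof (rule convexI)
    fix x y :: "real ^ 2" and a b :: real
    assume *: "x \<in> V - {0}" "y \<in> V - {0}" "0 \<le> a" "0 \<le> b" "a + b = 1"
    have ab: "a *\<^sub>R x \<in> V" "b *\<^sub>R y \<in> V" using * scale_V by auto
    have "a *\<^sub>R x + b *\<^sub>R y \<noteq> 0"
    proof
      assume "a *\<^sub>R x + b *\<^sub>R y = 0"
      then have "- (a *\<^sub>R x) = b *\<^sub>R y" by (simp add: add_eq_0_iff)
      then have "a *\<^sub>R x = 0" "b *\<^sub>R y = 0" using pointed[OF ab(1)] ab(2) by auto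
      then show False using * by auto
    qed
    then show "a *\<^sub>R x + b *\<^sub>R y \<in> V - {0}" using add_V[OF ab] by simp
  qed
  then have "convex hull ?K \<subseteq> V - {0}" by (intro hull_minimal) auto
  moreover have "closed (convex hull ?K)"
    using sphere_V by (simp add: compact_convex_hull compact_imp_closed)
  ultimately obtain a b where ab: "a \<bullet> 0 < b" "\<forall>x\<in>convex hull ?K. a \<bullet> x > b"
    using separating_hyperplane_closed_point[of "convex hull ?K" 0] by blast
  have "\<forall>y\<in>?K. (- a) \<bullet> y < 0" using ab hull_subset[of ?K convex] by force
  then have neg: "\<forall>y\<in>V - {0}. (- a) \<bullet> y < 0" using negative_iff_on_sphere by blast
  then obtain l s where "l > 0" "- a = l *\<^sub>R dir s"
    using functional_is_multiple_of_dir[of "- a"] v by blast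
  then have "s \<in> slopes" using neg by (simp add: slopes_def mult_less_0_iff)
  then show ?thesis by blast
qed

lemma supp_upper:
  assumes "bdd_above ((\<lambda>x. dir s \<bullet> x) ` A)" "x \<in> A"
  shows "dir s \<bullet> x \<le> supp A s"
  unfolding supp_def using assms by (intro cSUP_upper)

lemma supp_least:
  assumes "A \<noteq> {}" "\<And>x. x \<in> A \<Longrightarrow> dir s \<bullet> x \<le> m"
  shows "supp A s \<le> m"
  unfolding supp_def using assms by (intro cSUP_least)

text \<open>A functional \<open>u\<close> that separates \<open>x\<close> from \<open>A\<close> is bounded above on \<open>A\<close>, hence nonpositive on
  \<open>V\<close>, but it may vanish on a boundary ray of \<open>V\<close>. Adding a small multiple of \<open>dir s1\<close>, which is
  strictly negative on \<open>V - {0}\<close>, moves it into the interior of the polar cone without losing the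
  separation.\<close>

lemma exists_separating_dir:
  assumes A: "A \<noteq> {}" "closed A" "convex A" and VA: "\<And>y a. y \<in> V \<Longrightarrow> a \<in> A \<Longrightarrow> y + a \<in> A"
    and bdd: "\<And>s. s \<in> slopes \<Longrightarrow> bdd_above ((\<lambda>x. dir s \<bullet> x) ` A)"
    and "x \<notin> A"
  shows "\<exists>s\<in>slopes. supp A s < dir s \<bullet> x"
proof -
  obtain a' b' where "a' \<bullet> x < b'" "\<forall>y\<in>A. a' \<bullet> y > b'"
    using separating_hyperplane_closed_point[OF A(3,2) \<open>x \<notin> A\<close>] by blast
  then obtain u b where u: "u \<bullet> x > b" "\<And>y. y \<in> A \<Longrightarrow> u \<bullet> y < b"
    by (metis inner_minus_left neg_less_iff_less)
  obtain a0 where a0: "a0 \<in> A" using A(1) by blast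
  have nonpos: "u \<bullet> y \<le> 0" if "y \<in> V" for y
  proof (rule ccontr)
    assume *: "\<not> u \<bullet> y \<le> 0"
    define c where "c = (b - u \<bullet> a0) / (u \<bullet> y)"
    have "c \<ge> 0" using * u(2)[OF a0] by (simp add: c_def)
    then have "u \<bullet> (c *\<^sub>R y + a0) < b" using VA[OF scale_V[OF that] a0] u(2) by blast
    then show False using * by (simp add: c_def inner_add_right)
  qed
  obtain s1 where s1: "s1 \<in> slopes" using slopes_nonempty by blast
  define H where "H = supp A s1"
  define r where "r = H - dir s1 \<bullet> x"
  obtain e where e: "e > 0" "e * r < u \<bullet> x - b"
  proof
    show "(u \<bullet> x - b) / (\<bar>r\<bar> + 1) > 0" using u(1) by (simp add: add_nonneg_pos)
    have "(u \<bullet> x - b) * r < (u \<bullet> x - b) * (\<bar>r\<bar> + 1)" using u(1) by (intro mult_strict_left_mono) auto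
    then show "(u \<bullet> x - b) / (\<bar>r\<bar> + 1) * r < u \<bullet> x - b"
      by (simp add: divide_less_eq add_nonneg_pos)
  qed
  define u' where "u' = u + e *\<^sub>R dir s1"
  have neg: "u' \<bullet> y < 0" if "y \<in> V - {0}" for y
  proof -
    have "dir s1 \<bullet> y < 0" using s1 that by (simp add: slopes_def)
    then show ?thesis
      using nonpos[of y] that e(1) by (simp add: u'_def inner_add_left add_nonpos_neg mult_pos_neg)
  qed
  then obtain l s where ls: "l > 0" "u' = l *\<^sub>R dir s"
    using functional_is_multiple_of_dir[of u'] v by blast
  have s: "s \<in> slopes" using neg ls by (simp add: slopes_def mult_less_0_iff)
  have "l * (dir s \<bullet> y) \<le> b + e * H" if "y \<in> A" for y
  proof -
    have "dir s1 \<bullet> y \<le> H" using supp_upper[OF bdd[OF s1] that] by (simp add: H_def)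
    then have "u' \<bullet> y \<le> b + e * H"
      using u(2)[OF that] e(1) by (simp add: u'_def inner_add_left add_mono)
    then show ?thesis by (simp add: ls)
  qed
  then have "supp A s \<le> (b + e * H) / l"
    using ls(1) by (intro supp_least A(1)) (simp add: le_divide_eq mult.commute)
  also have "\<dots> < dir s \<bullet> x"
  proof -
    have "b + e * H < u' \<bullet> x"
      using e(2) by (simp add: u'_def inner_add_left r_def algebra_simps)
    then show ?thesis using ls by (simp add: divide_less_eq mult.commute)
  qed
  finally show ?thesis using s by blast
qed

text \<open>The bipolar theorem, an instance of the separation above with \<open>A = V\<close>.\<close>

lemma mem_V_iff: "y \<in> V \<longleftrightarrow> (\<forall>s\<in>slopes. dir s \<bullet> y \<le> 0)"
proof
  assume "y \<in> V"
  then show "\<forall>s\<in>slopes. dir s \<bullet> y \<le> 0" by (cases "y = 0") (auto simp: slopes_def intro: less_imp_le)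
next
  assume R: "\<forall>s\<in>slopes. dir s \<bullet> y \<le> 0"
  have nonpos: "dir s \<bullet> x \<le> 0" if "s \<in> slopes" "x \<in> V" for s x
    using that by (cases "x = 0") (auto simp: slopes_def intro: less_imp_le)
  show "y \<in> V"
  proof (rule ccontr)
    assume "y \<notin> V"
    moreover have "bdd_above ((\<lambda>x. dir s \<bullet> x) ` V)" if "s \<in> slopes" for s
      using nonpos[OF that] by (intro bdd_aboveI) auto
    ultimately obtain s where s: "s \<in> slopes" "supp V s < dir s \<bullet> y"
      using exists_separating_dir[of V y] closed_V convex_V v add_V by blast
    have "dir s \<bullet> 0 \<le> supp V s"
      using nonpos[OF s(1)] zero_V by (intro supp_upper bdd_aboveI) auto
    then show False using s R by auto
  qed
qed

text \<open>The recession cone is not larger than \<open>V\<close> when the set is bounded above in all directions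
  \<open>dir s\<close>: moving a point repeatedly by \<open>y \<notin> V\<close> would leave every half-plane of some such
  direction.\<close>

lemma familyI:
  assumes "A \<noteq> {}" "closed A" "convex A" and VA: "\<And>y a. y \<in> V \<Longrightarrow> a \<in> A \<Longrightarrow> y + a \<in> A"
    and bdd: "\<And>s. s \<in> slopes \<Longrightarrow> bdd_above ((\<lambda>x. dir s \<bullet> x) ` A)"
  shows "A \<in> family"
proof -
  have "y \<in> V" if y: "y +o A \<subseteq> A" for y
    unfolding mem_V_iff
  proof (rule ccontr)
    assume "\<not> (\<forall>s\<in>slopes. dir s \<bullet> y \<le> 0)"
    then obtain s where s: "s \<in> slopes" "dir s \<bullet> y > 0" by auto
    obtain a where a: "a \<in> A" using assms(1) by blast
    have step: "real n *\<^sub>R y + a \<in> A" for n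
    proof (induction n)
      case (Suc n)
      then have "y + (real n *\<^sub>R y + a) \<in> y +o A" by blast
      then show ?case using y by (auto simp: algebra_simps)
    qed (use a in simp)
    obtain n where "real n * (dir s \<bullet> y) > supp A s - dir s \<bullet> a"
      using s(2) reals_Archimedean3 by blast
    moreover have "dir s \<bullet> (real n *\<^sub>R y + a) \<le> supp A s" by (rule supp_upper[OF bdd[OF s(1)] step])
    ultimately show False by (simp add: inner_add_right)
  qed
  moreover have "y +o A \<subseteq> A" if "y \<in> V" for y using VA that by (auto simp: elt_set_plus_def)
  ultimately show ?thesis
    using assms(1-3) by (auto simp: closed_convex_family_def recession_cone_def)
qed

lemma familyD:
  assumes "A \<in> family"
  shows "A \<noteq> {}" "closed A" "convex A" "\<And>y a. y \<in> V \<Longrightarrow> a \<in> A \<Longrightarrow> y + a \<in> A"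
  using assms by (auto simp: closed_convex_family_def recession_cone_def elt_set_plus_def)

text \<open>An unbounded sequence in the slice would, after normalisation, converge to a unit recession
  direction \<open>d \<in> V\<close> of \<open>A\<close> with \<open>dir s \<bullet> d \<ge> 0\<close>. This one fact yields both the finiteness of
  support functions and the closedness of Minkowski sums.\<close>

lemma bounded_slice:
  assumes A: "A \<in> family" and s: "s \<in> slopes"
  shows "bounded (A \<inter> {x. c \<le> dir s \<bullet> x})"
proof (rule ccontr)
  assume "\<not> ?thesis"
  then have "\<exists>x \<in> A \<inter> {x. c \<le> dir s \<bullet> x}. real n + 1 < norm x" for n
    by (meson bounded_iff not_le)
  then obtain X where X: "\<And>n. X n \<in> A" "\<And>n. c \<le> dir s \<bullet> X n" "\<And>n. real n + 1 < norm (X n)"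
    by (metis IntE mem_Collect_eq)
  have pos: "norm (X n) > 0" for n using X(3)[of n] by linarith
  define N where "N n = norm (X n)" for n
  obtain d r where d: "d \<in> sphere 0 1" "strict_mono r" "((\<lambda>n. X n /\<^sub>R N n) \<circ> r) \<longlonglongrightarrow> d"
    using compact_sphere[of "0 :: real ^ 2" 1, unfolded compact_def, rule_format, of "\<lambda>n. X n /\<^sub>R N n"]
      pos by (auto simp: N_def)
  have lim: "(\<lambda>n. X (r n) /\<^sub>R N (r n)) \<longlonglongrightarrow> d" using d(3) by (simp add: o_def)
  have "filterlim N at_top sequentially"
    by (rule filterlim_at_top_mono[OF filterlim_real_sequentially])
      (use X(3) in \<open>auto simp: N_def intro!: always_eventually less_imp_le less_trans[OF _ X(3)]\<close>)
  then have "filterlim (\<lambda>n. N (r n)) at_top sequentially"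
    using filterlim_compose filterlim_subseq[OF d(2)] by blast
  then have inv: "(\<lambda>n. inverse (N (r n))) \<longlonglongrightarrow> 0" by (rule tendsto_inverse_0_at_top)
  have Npos: "N n > 0" for n using pos by (simp add: N_def)
  have "d \<in> recession_cone A"
    unfolding recession_cone_def mem_Collect_eq
  proof
    fix y assume "y \<in> d +o A"
    \<comment> \<open>With \<open>y = d + a\<close>, the point \<open>y\<close> is the limit of points on the segments from \<open>a\<close> to
      \<open>X (r n)\<close> at distance about \<open>1\<close> from \<open>a\<close>.\<close>
    then obtain a where a: "a \<in> A" "y = d + a" by (auto simp: elt_set_plus_def)
    have "(\<lambda>n. X (r n) /\<^sub>R N (r n) + (1 - inverse (N (r n))) *\<^sub>R a) \<longlonglongrightarrow> d + (1 - 0) *\<^sub>R a"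
      by (intro tendsto_intros lim inv)
    then have lim_y: "(\<lambda>n. X (r n) /\<^sub>R N (r n) + (1 - inverse (N (r n))) *\<^sub>R a) \<longlonglongrightarrow> y"
      by (simp add: a)
    have mem_A: "X (r n) /\<^sub>R N (r n) + (1 - inverse (N (r n))) *\<^sub>R a \<in> A" for n
    proof -
      have "N (r n) \<ge> 1" using X(3)[of "r n"] by (simp add: N_def)
      then have "inverse (N (r n)) \<le> 1" by (simp add: inverse_le_1_iff)
      then show ?thesis
        using familyD(3)[OF A] X(1) a(1) Npos[of "r n"] by (auto simp: convex_def)
    qed
    show "y \<in> A" by (rule closed_sequentially[OF familyD(2)[OF A] mem_A lim_y])
  qed
  then have "d \<in> V" using A by (simp add: closed_convex_family_def)
  moreover have "d \<noteq> 0" using d(1) by auto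
  ultimately have "dir s \<bullet> d < 0" using s by (simp add: slopes_def)
  moreover have "0 \<le> dir s \<bullet> d"
  proof (rule LIMSEQ_le)
    show "(\<lambda>n. c * inverse (N (r n))) \<longlonglongrightarrow> 0" using tendsto_mult_left[OF inv, of c] by simp
    show "(\<lambda>n. dir s \<bullet> (X (r n) /\<^sub>R N (r n))) \<longlonglongrightarrow> dir s \<bullet> d" by (intro tendsto_intros lim)
    show "\<exists>M. \<forall>n\<ge>M. c * inverse (N (r n)) \<le> dir s \<bullet> (X (r n) /\<^sub>R N (r n))"
      using X(2) Npos by (auto simp: mult.commute intro!: mult_left_mono less_imp_le)
  qed
  ultimately show False by simp
qed

lemma family_bdd:
  assumes A: "A \<in> family" and s: "s \<in> slopes"
  shows "bdd_above ((\<lambda>x. dir s \<bullet> x) ` A)"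
proof -
  obtain a where a: "a \<in> A" using familyD(1)[OF A] by blast
  let ?S = "A \<inter> {x. dir s \<bullet> a \<le> dir s \<bullet> x}"
  have "bounded ((\<lambda>x. dir s \<bullet> x) ` ?S)"
    by (rule bounded_linear_image[OF bounded_slice[OF A s] bounded_linear_inner_right])
  then obtain m where m: "\<And>x. x \<in> ?S \<Longrightarrow> dir s \<bullet> x \<le> m"
    by (metis bdd_above.unfold bounded_imp_bdd_above image_eqI)
  have "dir s \<bullet> x \<le> m" if "x \<in> A" for x
    using m[of x] m[of a] a that by (cases "dir s \<bullet> a \<le> dir s \<bullet> x") auto
  then show ?thesis by (intro bdd_aboveI) auto
qed

lemma mem_family_iff:
  assumes A: "A \<in> family"
  shows "x \<in> A \<longleftrightarrow> (\<forall>s\<in>slopes. dir s \<bullet> x \<le> supp A s)"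
proof
  assume "x \<in> A"
  then show "\<forall>s\<in>slopes. dir s \<bullet> x \<le> supp A s" using supp_upper[OF family_bdd[OF A]] by blast
next
  assume *: "\<forall>s\<in>slopes. dir s \<bullet> x \<le> supp A s"
  show "x \<in> A"
  proof (rule ccontr)
    assume "x \<notin> A"
    then obtain s where "s \<in> slopes" "supp A s < dir s \<bullet> x"
      using exists_separating_dir[of A x] familyD[OF A] family_bdd[OF A] by metis
    then show False using * by force
  qed
qed

lemma family_eqI:
  assumes "A \<in> family" "B \<in> family" "\<And>s. s \<in> slopes \<Longrightarrow> supp A s = supp B s"
  shows "A = B"
  using assms by (auto simp: mem_family_iff)

lemma convex_on_supp:
  assumes A: "A \<in> family"
  shows "convex_on slopes (supp A)"
  unfolding convex_on_def
proof (intro conjI ballI allI impI)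
  fix s t u w :: real assume *: "s \<in> slopes" "t \<in> slopes" "0 \<le> u" "0 \<le> w" "u + w = 1"
  show "supp A (u *\<^sub>R s + w *\<^sub>R t) \<le> u * supp A s + w * supp A t"
  proof (rule supp_least[OF familyD(1)[OF A]])
    fix x assume "x \<in> A"
    then have "dir s \<bullet> x \<le> supp A s" "dir t \<bullet> x \<le> supp A t"
      using supp_upper family_bdd[OF A] * by auto
    then show "dir (u *\<^sub>R s + w *\<^sub>R t) \<bullet> x \<le> u * supp A s + w * supp A t"
      using * by (simp add: dir_affine inner_add_left add_mono mult_left_mono)
  qed
qed (rule convex_slopes)

lemma supp_add:
  assumes A: "A \<noteq> {}" "bdd_above ((\<lambda>x. dir s \<bullet> x) ` A)"
    and B: "B \<noteq> {}" "bdd_above ((\<lambda>x. dir s \<bullet> x) ` B)"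
  shows "supp (A + B) s = supp A s + supp B s" "bdd_above ((\<lambda>x. dir s \<bullet> x) ` (A + B))"
proof -
  have le: "dir s \<bullet> x \<le> supp A s + supp B s" if "x \<in> A + B" for x
  proof -
    obtain a b where "a \<in> A" "b \<in> B" "x = a + b" using \<open>x \<in> A + B\<close> by (rule set_plus_elim)
    then show ?thesis
      using supp_upper[OF A(2), of a] supp_upper[OF B(2), of b] by (simp add: inner_add_right)
  qed
  then show bdd: "bdd_above ((\<lambda>x. dir s \<bullet> x) ` (A + B))" by (intro bdd_aboveI) auto
  have "dir s \<bullet> a + dir s \<bullet> b \<le> supp (A + B) s" if "a \<in> A" "b \<in> B" for a b
    using supp_upper[OF bdd, of "a + b"] that by (auto simp: inner_add_right)
  then have "supp A s \<le> supp (A + B) s - dir s \<bullet> b" if "b \<in> B" for b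
    using that by (intro supp_least A(1)) (simp add: le_diff_eq)
  then have "supp B s \<le> supp (A + B) s - supp A s"
    by (intro supp_least B(1)) (simp add: le_diff_eq add.commute)
  moreover have "supp (A + B) s \<le> supp A s + supp B s"
    using A(1) B(1) le by (intro supp_least) (auto simp: set_plus_def)
  ultimately show "supp (A + B) s = supp A s + supp B s" by simp
qed

text \<open>Near a limit point \<open>z\<close>, where \<open>dir s\<close> exceeds \<open>c\<close>, only those summands contribute that are not
  too low in direction \<open>dir s\<close>; they form compact slices, and the sum of two compact sets is closed.\<close>

lemma closed_add:
  assumes A: "A \<in> family" and B: "B \<in> family"
  shows "closed (A + B)"
proof -
  obtain s where s: "s \<in> slopes" using slopes_nonempty by blast
  show ?thesis unfolding closed_sequential_limits
  proof safe
    fix Z z assume Z: "\<forall>n. Z n \<in> A + B" and lim: "Z \<longlonglongrightarrow> z"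
    define c where "c = dir s \<bullet> z - 1"
    define A' where "A' = A \<inter> {x. c - supp B s \<le> dir s \<bullet> x}"
    define B' where "B' = B \<inter> {x. c - supp A s \<le> dir s \<bullet> x}"
    have "closed {x. m \<le> dir s \<bullet> x}" for m by (intro closed_Collect_le continuous_intros)
    then have "compact A'" "compact B'"
      unfolding A'_def B'_def compact_eq_bounded_closed
      using bounded_slice[OF A s] bounded_slice[OF B s] familyD(2) A B by auto
    then have "compact {x + y |x y. x \<in> A' \<and> y \<in> B'}" by (rule compact_sums)
    moreover have "{x + y |x y. x \<in> A' \<and> y \<in> B'} = A' + B'" by (auto simp: set_plus_def)
    ultimately have cl: "closed (A' + B')" using compact_imp_closed by simp
    have "(\<lambda>n. dir s \<bullet> Z n) \<longlonglongrightarrow> dir s \<bullet> z" by (intro tendsto_intros lim)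
    then have "eventually (\<lambda>n. c < dir s \<bullet> Z n) sequentially"
      by (rule order_tendstoD) (simp add: c_def)
    then have "eventually (\<lambda>n. Z n \<in> A' + B') sequentially"
    proof eventually_elim
      case (elim n)
      obtain a b where ab: "a \<in> A" "b \<in> B" "Z n = a + b" using Z by (meson set_plus_elim)
      have "dir s \<bullet> a \<le> supp A s" "dir s \<bullet> b \<le> supp B s"
        using supp_upper family_bdd A B s ab by auto
      then have "a \<in> A'" "b \<in> B'" using elim ab by (auto simp: A'_def B'_def inner_add_right)
      then show ?case by (simp add: ab(3) set_plus_intro)
    qed
    then have "z \<in> A' + B'" using cl lim by (metis Lim_in_closed_set sequentially_bot)
    then show "z \<in> A + B" by (auto simp: A'_def B'_def set_plus_def)
  qed
qed

lemma family_add: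
  assumes A: "A \<in> family" and B: "B \<in> family"
  shows "A + B \<in> family"
proof (rule familyI)
  obtain a b where "a \<in> A" "b \<in> B" using familyD(1)[OF A] familyD(1)[OF B] by blast
  then have "a + b \<in> A + B" by (rule set_plus_intro)
  then show "A + B \<noteq> {}" by blast
  show "convex (A + B)" using familyD(3) A B by (simp add: convex_set_plus)
  show "y + x \<in> A + B" if "y \<in> V" "x \<in> A + B" for y x
  proof -
    obtain a b where ab: "a \<in> A" "b \<in> B" "x = a + b" using \<open>x \<in> A + B\<close> by (rule set_plus_elim)
    then have "(y + a) + b \<in> A + B" using familyD(4)[OF A that(1)] by (intro set_plus_intro)
    then show ?thesis by (simp add: ab(3) add.assoc)
  qed
  show "bdd_above ((\<lambda>x. dir s \<bullet> x) ` (A + B))" if "s \<in> slopes" for s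
    by (rule supp_add(2)[OF familyD(1)[OF A] family_bdd[OF A that] familyD(1)[OF B] family_bdd[OF B that]])
qed (rule closed_add[OF A B])

lemma supp_family_add:
  assumes A: "A \<in> family" and B: "B \<in> family" and s: "s \<in> slopes"
  shows "supp (A + B) s = supp A s + supp B s"
  by (rule supp_add(1)[OF familyD(1)[OF A] family_bdd[OF A s] familyD(1)[OF B] family_bdd[OF B s]])

text \<open>Every convex function is the support function of its Wulff shape because each of its supporting
  lines is given by a point of that shape.\<close>

lemma family_wulff:
  assumes f: "convex_on slopes f"
  shows "wulff f \<in> family" "\<And>s. s \<in> slopes \<Longrightarrow> supp (wulff f) s = f s"
proof -
  have touch: "\<exists>x\<in>wulff f. dir s \<bullet> x = f s" if s: "s \<in> slopes" for s
  proof -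
    define k where "k = right_slope slopes f s"
    have k: "f s + k * (t - s) \<le> f t" if "t \<in> slopes" for t
      using subgradient_on_right_slope[OF f open_slopes] s that by (simp add: k_def subgradient_on_def)
    obtain x where x: "\<And>t. dir t \<bullet> x = (f s - k * s) + k * t"
      using exists_prescribed_values by blast
    have "dir t \<bullet> x \<le> f t" if "t \<in> slopes" for t
      using k[OF that] x[of t] by (simp add: algebra_simps)
    then have "x \<in> wulff f" by (simp add: wulff_def)
    moreover have "dir s \<bullet> x = f s" using x[of s] by simp
    ultimately show ?thesis by blast
  qed
  have bdd: "bdd_above ((\<lambda>x. dir s \<bullet> x) ` wulff f)" if "s \<in> slopes" for s
    using that by (intro bdd_aboveI[of _ "f s"]) (auto simp: wulff_def)
  obtain s0 where s0: "s0 \<in> slopes" using slopes_nonempty by blast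
  show "wulff f \<in> family"
  proof (rule familyI)
    show "wulff f \<noteq> {}" using touch[OF s0] by blast
    have eq: "wulff f = (\<Inter>s\<in>slopes. {x. dir s \<bullet> x \<le> f s})" by (auto simp: wulff_def)
    show "closed (wulff f)" unfolding eq by (intro closed_INT ballI closed_halfspace_le)
    show "convex (wulff f)" unfolding eq by (intro convex_INT convex_halfspace_le)
    show "y + a \<in> wulff f" if "y \<in> V" "a \<in> wulff f" for y a
      using that by (force simp: wulff_def mem_V_iff inner_add_right)
  qed (rule bdd)
  show "supp (wulff f) s = f s" if s: "s \<in> slopes" for s
  proof (rule antisym)
    show "supp (wulff f) s \<le> f s" using touch[OF s] s by (intro supp_least) (auto simp: wulff_def)
    show "f s \<le> supp (wulff f) s" using touch[OF s] supp_upper[OF bdd[OF s]] by metis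
  qed
qed

lemma family_translate:
  assumes "A \<in> family" shows "x +o A \<in> family"
proof (rule familyI)
  show "x +o A \<noteq> {}" using familyD(1)[OF assms] by (auto simp: elt_set_plus_def)
  have eq: "x +o A = (+) x ` A" by (auto simp: elt_set_plus_def)
  show "closed (x +o A)" "convex (x +o A)" unfolding eq
    using familyD[OF assms] by (auto simp: closed_translation convex_translation)
  show "y + a \<in> x +o A" if "y \<in> V" "a \<in> x +o A" for y a
    using that familyD(4)[OF assms that(1)] by (auto simp: elt_set_plus_def add.left_commute)
  show "bdd_above ((\<lambda>x. dir s \<bullet> x) ` (x +o A))" if "s \<in> slopes" for s
  proof (rule bdd_aboveI)
    fix y assume "y \<in> (\<lambda>x. dir s \<bullet> x) ` (x +o A)"
    then show "y \<le> dir s \<bullet> x + supp A s"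
      using supp_upper[OF family_bdd[OF assms that]] by (auto simp: elt_set_plus_def inner_add_right)
  qed
qed

text \<open>The four sets are the Wulff shapes of \<open>supp A - q\<close>, \<open>q\<close>, \<open>q - (supp A - supp B)\<close> and
  \<open>supp C - q\<close>, where \<open>q\<close> interpolates as above.\<close>

lemma Riesz_refinement:
  assumes A: "A \<in> family" and B: "B \<in> family" and C: "C \<in> family" and D: "D \<in> family"
    and eq: "A + D = B + C"
  shows "\<exists>P\<in>family. \<exists>Q\<in>family. \<exists>R\<in>family. \<exists>S\<in>family.
    A = P + Q \<and> B = P + R \<and> C = Q + S \<and> D = R + S"
proof -
  have sum: "supp A t + supp D t = supp B t + supp C t" if "t \<in> slopes" for t
    using supp_family_add[OF A D that] supp_family_add[OF B C that] eq by simp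
  obtain q where q: "convex_on slopes q"
    "convex_on slopes (\<lambda>t. q t - (supp A t - supp B t))"
    "convex_on slopes (\<lambda>t. supp A t - q t)" "convex_on slopes (\<lambda>t. supp C t - q t)"
    using convex_on_Riesz_interpolation[OF open_slopes convex_on_supp[OF A] convex_on_supp[OF B]
        convex_on_supp[OF C] convex_on_supp[OF D] sum] by blast
  note fam = family_wulff(1)[OF q(1)] family_wulff(1)[OF q(2)]
    family_wulff(1)[OF q(3)] family_wulff(1)[OF q(4)]
  note supps = family_wulff(2)[OF q(1)] family_wulff(2)[OF q(2)]
    family_wulff(2)[OF q(3)] family_wulff(2)[OF q(4)]
  let ?Q = "wulff q" and ?R = "wulff (\<lambda>t. q t - (supp A t - supp B t))"
    and ?P = "wulff (\<lambda>t. supp A t - q t)" and ?S = "wulff (\<lambda>t. supp C t - q t)"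
  have "A = ?P + ?Q"
    by (rule family_eqI[OF A family_add[OF fam(3,1)]]) (simp add: supp_family_add fam supps)
  moreover have "B = ?P + ?R"
    by (rule family_eqI[OF B family_add[OF fam(3,2)]]) (simp add: supp_family_add fam supps)
  moreover have "C = ?Q + ?S"
    by (rule family_eqI[OF C family_add[OF fam(1,4)]]) (simp add: supp_family_add fam supps)
  moreover have "D = ?R + ?S"
  proof (rule family_eqI[OF D family_add[OF fam(2,4)]])
    fix t assume t: "t \<in> slopes"
    then show "supp D t = supp (?R + ?S) t"
      using sum[OF t] by (simp add: supp_family_add fam supps)
  qed
  ultimately show ?thesis using fam by blast
qed

end

section \<open>Minimal pairs are reduced\<close>

theorem theorem4p6:
  fixes V A B :: "(real ^ 2) set"
  assumes "closed V" and "convex V" and "pointed_cone V" and "\<not> bounded V"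
    and "A \<in> closed_convex_family V" and "B \<in> closed_convex_family V"
    and "zero_minimal V (A, B)"
  shows "reduced_pair V (A, B)"
proof -
  have "\<not> V \<subseteq> {0}" using \<open>\<not> bounded V\<close> bounded_subset[of "{0}" V] by auto
  then obtain v where "v \<in> V" "v \<noteq> 0" by blast
  then interpret planar_cone V v using assms(1-3) by unfold_locales
  have minimal: "C' = A" "D' = B"
    if "C' \<in> family" "D' \<in> family" "A + D' = B + C'" "0 \<in> D'" "C' \<subseteq> A" "D' \<subseteq> B" for C' D'
    using assms(7) that
    by (auto simp: zero_minimal_def minimal_pair_in_def pair_class_def pair_le_def)
  have "0 \<in> B"
    using assms(7) by (simp add: zero_minimal_def minimal_pair_in_def)
  have key: "\<exists>M\<in>family. C = A + M \<and> D = B + M"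
    if CD: "C \<in> family" "D \<in> family" "A + D = B + C" for C D
  proof -
    obtain P Q R S where fam: "P \<in> family" "Q \<in> family" "R \<in> family" "S \<in> family"
      and dec: "A = P + Q" "B = P + R" "C = Q + S" "D = R + S"
      using Riesz_refinement[OF assms(5,6) CD] by blast
    obtain p r where pr: "p \<in> P" "r \<in> R" "p + r = 0"
    proof -
      have "0 \<in> P + R" using \<open>0 \<in> B\<close> dec(2) by simp
      then show thesis by (rule set_plus_elim) (rule that, simp_all)
    qed
    have "A + (p +o R) = B + (p +o Q)"
      unfolding dec set_plus_rearrange4 by (simp add: ac_simps)
    moreover have "0 \<in> p +o R" using set_plus_intro2[OF pr(2), of p] pr(3) by simp
    moreover have "p +o Q \<subseteq> A" "p +o R \<subseteq> B" unfolding dec by (rule set_plus_mono3[OF pr(1)])+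
    ultimately have AB: "p +o Q = A" "p +o R = B"
      using minimal[of "p +o Q" "p +o R"] fam family_translate by auto
    have "A + (- p +o S) = C" "B + (- p +o S) = D"
      unfolding dec(3,4) by (simp_all add: AB[symmetric] set_plus_rearrange)
    then show ?thesis using family_translate[OF fam(4), of "- p"] by blast
  qed
  show ?thesis
    unfolding reduced_pair_def
  proof (intro equalityI subsetI)
    fix Z assume "Z \<in> pair_class V (A, B)"
    then obtain C D where "Z = (C, D)" "C \<in> family" "D \<in> family" "A + D = B + C"
      by (auto simp: pair_class_def)
    then show "Z \<in> {(fst (A, B) + M, snd (A, B) + M) |M. M \<in> family}"
      using key[of C D] by auto
  next
    fix Z assume "Z \<in> {(fst (A, B) + M, snd (A, B) + M) |M. M \<in> family}"
    then obtain M where "Z = (A + M, B + M)" "M \<in> family" by auto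
    then show "Z \<in> pair_class V (A, B)"
      using family_add[OF assms(5)] family_add[OF assms(6)]
      by (simp add: pair_class_def add.left_commute)
  qed
qed

end
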